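(* Let $n$ be a product of one or more natural numbers each of which is of one of the following forms: (1) a prime of the form $6t+1$ with $t$ a natural number; (2) the square of a prime of the form $6t-1$ with $t$ a natural number; (3) $2^k-1$ with $k>2$ a natural number. Then there exists a Steiner triple system of order $n$ with enough pasch configurations.
   Context: A Steiner triple system of order $n$ is a pair $(X,S)$ with $|X|=n$ and $S$ a set of 3-subsets of $X$ (blocks) such that every pair of distinct elements lies in exactly one block. A pasch configuration is a set of four 3-subsets $\{a,b,c\},\{a,d,e\},\{f,b,d\},\{f,c,e\}$ with $a,b,c,d,e,f$ distinct. $S$ has enough pasch configurations if every block of $S$ belongs to at least one pasch configuration contained in $S$ (equivalently, with $a\star b$ the third element of the block through $a\neq b$, the sets $A(S)=\{\{a\star b,b\star c,c\star a\}: a,b,c \text{ distinct},\{a,b,c\}\notin S\}$ and $B(S)=\{\{a\star b,b\star c,c\star a\}: a,b,c\text{ distinct}\}$ have equal cardinality). *)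

theory Defs
  imports Main "HOL-Computational_Algebra.Primes"
begin

definition steiner_triple_system :: "'a set \<Rightarrow> 'a set set \<Rightarrow> bool" where
  "steiner_triple_system X S \<longleftrightarrow>
     finite X \<and>
     (\<forall>B\<in>S. B \<subseteq> X \<and> card B = 3) \<and>
     (\<forall>x\<in>X. \<forall>y\<in>X. x \<noteq> y \<longrightarrow> (\<exists>!B. B \<in> S \<and> {x, y} \<subseteq> B))"

definition pasch_configuration :: "'a set set \<Rightarrow> bool" where
  "pasch_configuration P \<longleftrightarrow>
     (\<exists>a b c d e f. distinct [a, b, c, d, e, f] \<and>
        P = {{a, b, c}, {a, d, e}, {f, b, d}, {f, c, e}})"

definition enough_pasch_configurations :: "'a set set \<Rightarrow> bool" where
  "enough_pasch_configurations S \<longleftrightarrow>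
     (\<forall>B\<in>S. \<exists>P. pasch_configuration P \<and> P \<subseteq> S \<and> B \<in> P)"

text \<open>The condition p = 6t - 1 is written p + 1 = 6t, avoiding truncated subtraction.\<close>

definition admissible_factor :: "nat \<Rightarrow> bool" where
  "admissible_factor m \<longleftrightarrow>
     (prime m \<and> (\<exists>t::nat. m = 6 * t + 1)) \<or>
     (\<exists>p. prime p \<and> (\<exists>t::nat. p + 1 = 6 * t) \<and> m = p ^ 2) \<or>
     (\<exists>k::nat. k > 2 \<and> m = 2 ^ k - 1)"

end

theory Submission
  imports Defs "HOL-Number_Theory.Residue_Primitive_Roots" "HOL-Library.Product_Plus"
begin

text \<open>
  A Steiner triple system is the same as an idempotent commutative operation \<open>*\<close> with
  \<open>x * (x * y) = y\<close>, and the block through \<open>a, b\<close> lies in a pasch configuration iff some \<open>d\<close>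
  outside the block satisfies \<open>(b * d) * (a * b) = a * d\<close>. Being equational, this property passes
  to products: where the coordinates of \<open>a\<close> and \<open>b\<close> agree, take the same coordinate for \<open>d\<close>.

  For \<open>2 ^ k - 1\<close> the nonzero vectors over the field with two elements do. In the other two cases
  the points form a finite quotient \<open>M\<close> of the Eisenstein integers of order prime to 6. Let \<open>r\<close> be
  multiplication by a primitive sixth root of unity. The blocks are equilateral triangles
  \<open>{x, x + d, x + r d}\<close>, where a choice of sign decides, for each \<open>d\<close>, on which side of the
  segment from \<open>x\<close> to \<open>x + d\<close> the third vertex lies; the choice only has to change under \<open>r\<close>. If
  \<open>2 d\<close> has the same sign as \<open>d\<close>, then a triangle of side \<open>2 d\<close> and the three corner triangles of
  its subdivision form a pasch configuration. It therefore suffices that each \<open>d\<close> has the sign of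
  \<open>2 d\<close> or of \<open>d / 2\<close>, and such signs exist on every orbit of the group generated by 2 and \<open>r\<close>.
\<close>

section \<open>Steiner triple systems as quasigroups\<close>

definition pasch_quasigroup :: "'a set \<Rightarrow> ('a \<Rightarrow> 'a \<Rightarrow> 'a) \<Rightarrow> bool" where
  "pasch_quasigroup X f \<longleftrightarrow> finite X \<and>
     (\<forall>x\<in>X. \<forall>y\<in>X. f x y \<in> X \<and> f x y = f y x \<and> f x (f x y) = y) \<and>
     (\<forall>x\<in>X. f x x = x) \<and>
     (\<forall>a\<in>X. \<forall>b\<in>X. a \<noteq> b \<longrightarrow>
        (\<exists>d\<in>X. d \<noteq> a \<and> d \<noteq> b \<and> d \<noteq> f a b \<and> f (f b d) (f a b) = f a d))"

text \<open>Any two points of \<open>{x, y, f x y}\<close> yield the third under \<open>f\<close>,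
  so the block through two points is unique.\<close>

lemma pasch_quasigroup_steiner:
  assumes "pasch_quasigroup X f"
  shows "\<exists>S. steiner_triple_system X S \<and> enough_pasch_configurations S"
proof -
  define S where "S = {{x, y, f x y} | x y. x \<in> X \<and> y \<in> X \<and> x \<noteq> y}"
  have fin: "finite X"
    and cl: "f x y \<in> X" and comm: "f x y = f y x" and inv: "f x (f x y) = y" and idem: "f x x = x"
    if "x \<in> X" "y \<in> X" for x y
    using assms that unfolding pasch_quasigroup_def by auto
  have finX: "finite X" using assms unfolding pasch_quasigroup_def by auto
  have ne1: "f x y \<noteq> x" if "x \<in> X" "y \<in> X" "x \<noteq> y" for x y
    using that inv idem by metis
  have ne2: "f x y \<noteq> y" if "x \<in> X" "y \<in> X" "x \<noteq> y" for x y
    using that ne1 comm by metis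
  have blockI: "{x, y, f x y} \<in> S" if "x \<in> X" "y \<in> X" "x \<noteq> y" for x y
    using that unfolding S_def by blast
  have block_eq: "B = {x, y, f x y}" if "B \<in> S" "x \<in> B" "y \<in> B" "x \<noteq> y" for B x y
  proof -
    obtain u v where B: "B = {u, v, f u v}" "u \<in> X" "v \<in> X" "u \<noteq> v"
      using \<open>B \<in> S\<close> unfolding S_def by blast
    have "f v (f u v) = u" "f u (f u v) = v" "f v u = f u v" "f (f u v) v = u" "f (f u v) u = v"
      using B(2,3) inv comm cl by metis+
    then show ?thesis using that(2-4) B(1) by auto
  qed
  have "steiner_triple_system X S"
    unfolding steiner_triple_system_def
  proof (intro conjI ballI impI)
    show "finite X" by (fact finX)
  next
    fix B assume "B \<in> S"
    then obtain u v where B: "B = {u, v, f u v}" "u \<in> X" "v \<in> X" "u \<noteq> v"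
      unfolding S_def by blast
    show "B \<subseteq> X" using B cl by auto
    show "card B = 3" using B ne1[of u v] ne2[of u v] by auto
  next
    fix x y assume xy: "x \<in> X" "y \<in> X" "x \<noteq> y"
    show "\<exists>!B. B \<in> S \<and> {x, y} \<subseteq> B"
    proof (rule ex1I[of _ "{x, y, f x y}"])
      show "{x, y, f x y} \<in> S \<and> {x, y} \<subseteq> {x, y, f x y}" using blockI[OF xy] by simp
    next
      fix B assume "B \<in> S \<and> {x, y} \<subseteq> B"
      then show "B = {x, y, f x y}" using block_eq[of B x y] xy by simp
    qed
  qed
  moreover have "enough_pasch_configurations S"
    unfolding enough_pasch_configurations_def
  proof
    fix B assume "B \<in> S"
    then obtain a b where B: "B = {a, b, f a b}" "a \<in> X" "b \<in> X" "a \<noteq> b"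
      unfolding S_def by blast
    then obtain d where d: "d \<in> X" "d \<noteq> a" "d \<noteq> b" "d \<noteq> f a b" "f (f b d) (f a b) = f a d"
      using assms unfolding pasch_quasigroup_def by metis
    \<comment> \<open>These complete \<open>a, b, d\<close> to the six points of the configuration;
      the equation for \<open>d\<close> makes \<open>{g, c, e}\<close> a block.\<close>
    define c e g where "c = f a b" and "e = f a d" and "g = f b d"
    have X: "c \<in> X" "e \<in> X" "g \<in> X" using B d cl unfolding c_def e_def g_def by auto
    have c: "c \<noteq> a" "c \<noteq> b" "c \<noteq> d" using ne1 ne2 B d unfolding c_def by metis+
    have e: "e \<noteq> a" "e \<noteq> d" "e \<noteq> b" "e \<noteq> c"
      using ne1 ne2 inv B d unfolding c_def e_def by metis+
    have g: "g \<noteq> b" "g \<noteq> d" "g \<noteq> a" "g \<noteq> c" "g \<noteq> e"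
      using ne1 ne2 inv comm B d unfolding c_def e_def g_def by metis+
    define P where "P = {{a, b, c}, {a, d, e}, {g, b, d}, {g, c, e}}"
    have "pasch_configuration P"
      unfolding pasch_configuration_def P_def
      by (rule exI[of _ a], rule exI[of _ b], rule exI[of _ c], rule exI[of _ d],
          rule exI[of _ e], rule exI[of _ g]) (use B d c e g in auto)
    moreover have "{a, b, c} \<in> S" "{a, d, e} \<in> S" "{b, d, g} \<in> S" "{g, c, e} \<in> S"
      using blockI[of a b] blockI[of a d] blockI[of b d] blockI[of g c] B d X g
      unfolding c_def e_def g_def by auto
    then have "P \<subseteq> S" unfolding P_def by (simp add: insert_commute)
    moreover have "B \<in> P" unfolding P_def B(1) c_def by simp
    ultimately show "\<exists>P. pasch_configuration P \<and> P \<subseteq> S \<and> B \<in> P" by blast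
  qed
  ultimately show ?thesis by blast
qed

section \<open>Transport, products and orders\<close>

lemma pasch_quasigroup_bij:
  assumes "pasch_quasigroup X f" "bij_betw h X Y"
  shows "pasch_quasigroup Y (\<lambda>u v. h (f (inv_into X h u) (inv_into X h v)))"
proof -
  have Y: "Y = h ` X" and inj: "inj_on h X" using assms(2) by (auto simp: bij_betw_def)
  have f: "f x y \<in> X" "f x y = f y x" "f x (f x y) = y" if "x \<in> X" "y \<in> X" for x y
    using assms(1) that unfolding pasch_quasigroup_def by auto
  have 1: "inv_into X h (h x) = x" if "x \<in> X" for x using inj that by simp
  have 2: "h x = h y \<longleftrightarrow> x = y" if "x \<in> X" "y \<in> X" for x y
    using inj that by (auto simp: inj_on_def)
  have "finite X" "\<forall>x\<in>X. f x x = x"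
    and 3: "\<And>a b. a \<in> X \<Longrightarrow> b \<in> X \<Longrightarrow> a \<noteq> b \<Longrightarrow>
      \<exists>d\<in>X. d \<noteq> a \<and> d \<noteq> b \<and> d \<noteq> f a b \<and> f (f b d) (f a b) = f a d"
    using assms(1) unfolding pasch_quasigroup_def by auto
  then show ?thesis
    unfolding pasch_quasigroup_def Y
    by (intro conjI) (auto simp: 1 2 f dest!: 3)
qed

lemma pasch_quasigroup_prod:
  assumes "pasch_quasigroup X f" "pasch_quasigroup Y g"
  shows "pasch_quasigroup (X \<times> Y) (\<lambda>u v. (f (fst u) (fst v), g (snd u) (snd v)))"
proof -
  \<comment> \<open>Each coordinate is solved alone, with inequations only where \<open>a\<close>
    and \<open>b\<close> differ. Some coordinate does differ, and there they keep the pair of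
    solutions off the block.\<close>
  have ex: "\<exists>d\<in>Z. h (h b d) (h a b) = h a d \<and> (a \<noteq> b \<longrightarrow> d \<noteq> a \<and> d \<noteq> b \<and> d \<noteq> h a b)"
    if "pasch_quasigroup Z h" "a \<in> Z" "b \<in> Z" for Z and h :: "'c \<Rightarrow> 'c \<Rightarrow> 'c" and a b
  proof (cases "a = b")
    case True
    then show ?thesis using that unfolding pasch_quasigroup_def by (intro bexI[of _ a]) auto
  next
    case False
    then show ?thesis using that unfolding pasch_quasigroup_def by blast
  qed
  have "\<exists>d\<in>X \<times> Y. d \<noteq> u \<and> d \<noteq> v \<and> d \<noteq> (f (fst u) (fst v), g (snd u) (snd v)) \<and>
      (f (f (fst v) (fst d)) (f (fst u) (fst v)), g (g (snd v) (snd d)) (g (snd u) (snd v)))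
        = (f (fst u) (fst d), g (snd u) (snd d))"
    if uv: "u \<in> X \<times> Y" "v \<in> X \<times> Y" "u \<noteq> v" for u v
  proof -
    obtain a a' b b' where eq: "u = (a, a')" "v = (b, b')" by fastforce
    obtain d where d: "d \<in> X" "f (f b d) (f a b) = f a d"
        "a \<noteq> b \<longrightarrow> d \<noteq> a \<and> d \<noteq> b \<and> d \<noteq> f a b"
      using ex[OF assms(1), of a b] uv eq by auto
    obtain d' where d': "d' \<in> Y" "g (g b' d') (g a' b') = g a' d'"
        "a' \<noteq> b' \<longrightarrow> d' \<noteq> a' \<and> d' \<noteq> b' \<and> d' \<noteq> g a' b'"
      using ex[OF assms(2), of a' b'] uv eq by auto
    show ?thesis using d d' uv eq by (intro bexI[of _ "(d, d')"]) auto
  qed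
  then show ?thesis
    using assms unfolding pasch_quasigroup_def by (simp add: mem_Times_iff)
qed

text \<open>A definition cannot quantify over types, so the carrier is a set of naturals; transport
  along a bijection shows that nothing is lost.\<close>

definition pasch_order :: "nat \<Rightarrow> bool" where
  "pasch_order n \<longleftrightarrow> (\<exists>(X :: nat set) f. pasch_quasigroup X f \<and> card X = n)"

lemma pasch_orderI:
  assumes "pasch_quasigroup X f"
  shows "pasch_order (card X)"
proof -
  have "finite X" using assms unfolding pasch_quasigroup_def by blast
  then obtain h where "bij_betw h X {0..<card X}" using ex_bij_betw_finite_nat by blast
  from pasch_quasigroup_bij[OF assms this] show ?thesis
    unfolding pasch_order_def by fastforce
qed

lemma pasch_order_mult:
  assumes "pasch_order m" "pasch_order n"
  shows "pasch_order (m * n)"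
proof -
  obtain X Y :: "nat set" and f g where "pasch_quasigroup X f" "pasch_quasigroup Y g"
      "card X = m" "card Y = n"
    using assms unfolding pasch_order_def by blast
  with pasch_orderI[OF pasch_quasigroup_prod, of X f Y g] show ?thesis
    by (simp add: card_cartesian_product)
qed

lemma pasch_order_1: "pasch_order 1"
  using pasch_orderI[of "{0::nat}" "\<lambda>_ _. 0"] by (simp add: pasch_quasigroup_def)

section \<open>Projective spaces over the field with two elements\<close>

lemma pasch_order_projective_space:
  assumes "k > 2"
  shows "pasch_order (2 ^ k - 1)"
proof -
  let ?X = "{1..<2 ^ k} :: nat set"
  \<comment> \<open>Binary digits code vectors and \<open>xor\<close> adds them; the diagonal is
    redefined to make \<open>f\<close> idempotent and to avoid 0.\<close>
  define f :: "nat \<Rightarrow> nat \<Rightarrow> nat" where "f = (\<lambda>a b. if a = b then a else xor a b)"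
  have assoc: "xor a (xor a b) = b" for a b :: nat
    by (simp flip: xor.assoc)
  have assoc': "xor a (xor b a) = b" for a b :: nat
    by (metis assoc xor.commute)
  have eq0: "xor a b = 0 \<longleftrightarrow> a = b" for a b :: nat
    using assoc[of a b] by auto
  have eqa: "xor a b = a \<longleftrightarrow> b = 0" "xor a b = b \<longleftrightarrow> a = 0" for a b :: nat
    by (metis assoc xor.comm_neutral xor_self_eq xor.commute)+
  have eqa': "a = xor a b \<longleftrightarrow> b = 0" "b = xor a b \<longleftrightarrow> a = 0" for a b :: nat
    using eqa by metis+
  have pos: "0 < xor a b \<longleftrightarrow> a \<noteq> b" for a b :: nat
    using eq0[of a b] by (simp only: zero_less_iff_neq_zero not_False_eq_True)
  have lt: "xor a b < 2 ^ k" if "a < 2 ^ k" "b < 2 ^ k" for a b :: nat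
    using that by (metis take_bit_nat_eq_self take_bit_xor take_bit_nat_less_exp)
  have "\<exists>d\<in>?X. d \<noteq> a \<and> d \<noteq> b \<and> d \<noteq> f a b \<and> f (f b d) (f a b) = f a d"
    if ab: "a \<in> ?X" "b \<in> ?X" "a \<noteq> b" for a b
  proof -
    \<comment> \<open>There are at least seven points, so some \<open>d\<close> lies off the block;
      any such \<open>d\<close> works, as the two summands \<open>b\<close> cancel.\<close>
    have "(2::nat) ^ 3 \<le> 2 ^ k" using assms by (intro power_increasing) auto
    then have "card {a, b, f a b} < card ?X" by (auto simp: card_insert_if)
    then obtain d where d: "d \<in> ?X" "d \<notin> {a, b, f a b}"
      by (meson card_mono finite.emptyI finite.insertI leD subsetI)
    have 1: "f a b = xor a b" "f b d = xor b d" "f a d = xor a d"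
      using ab d by (auto simp: f_def)
    have "xor b d \<noteq> xor a b"
      using d ab 1 assoc by (metis insertI1 xor.commute)
    then have "f (f b d) (f a b) = xor (xor b d) (xor a b)" unfolding 1 by (simp add: f_def)
    also have "\<dots> = xor a d" by (simp add: ac_simps assoc)
    finally show ?thesis using d 1 by auto
  qed
  moreover have "f x y \<in> ?X" "f x y = f y x" "f x (f x y) = y" if "x \<in> ?X" "y \<in> ?X" for x y
    using that lt[of x y] pos[of x y]
    by (auto simp: f_def assoc assoc' eqa eqa' xor.commute[of x y] Suc_le_eq)
  moreover have "f x x = x" for x by (simp add: f_def)
  ultimately have "pasch_quasigroup ?X f"
    unfolding pasch_quasigroup_def by (intro conjI ballI impI) auto
  from pasch_orderI[OF this] show ?thesis by simp
qed

section \<open>Quotients of the Eisenstein integers\<close>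

text \<open>
  The points are the values of the quotient map \<open>N\<close>; computations take place upstairs, where
  \<open>N x = N y\<close> is congruence modulo its kernel.
\<close>

locale eisenstein_quotient =
  fixes r :: "'a::ab_group_add \<Rightarrow> 'a" and N :: "'a \<Rightarrow> 'b" and e :: nat
  assumes r_add: "r (x + y) = r x + r y"
    and r_r: "r (r x) = r x - x"
    and N_add: "N x = N x' \<Longrightarrow> N y = N y' \<Longrightarrow> N (x + y) = N (x' + y')"
    and N_minus: "N x = N y \<Longrightarrow> N (- x) = N (- y)"
    and N_r: "N x = N y \<Longrightarrow> N (r x) = N (r y)"
    and e_pos: "e > 0"
    and N_double_e: "N (((\<lambda>x. x + x) ^^ e) x) = N x"
    and N_triple: "N (x + x + x) = N 0 \<Longrightarrow> N x = N 0"
    and finite_N: "finite (range N)"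
begin

abbreviation double :: "'a \<Rightarrow> 'a" where "double \<equiv> \<lambda>x. x + x"

text \<open>
  The \<open>level\<close> of \<open>x\<close> is the least number of doublings leading from the representative of its
  orbit to \<open>x\<close>, up to powers of \<open>r\<close>; the parity of the power of \<open>r\<close> is the sign of \<open>x\<close>
  (even is \<open>upward\<close>).
\<close>

definition act :: "nat \<Rightarrow> nat \<Rightarrow> 'a \<Rightarrow> 'a" where
  "act i j x = (double ^^ i) ((r ^^ j) x)"

text \<open>Natural exponents suffice for group orbits, since modulo the kernel doubling and
  \<open>r\<close> have the periods \<open>e\<close> and 6.\<close>

definition orbit :: "'a \<Rightarrow> 'a set" where
  "orbit x = {y. \<exists>i j. N y = N (act i j x)}"

text \<open>The choice depends only on the orbit as a set, so all members of an orbit share one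
  representative.\<close>

definition base :: "'a \<Rightarrow> 'a" where
  "base x = (SOME y. y \<in> orbit x)"

definition level :: "'a \<Rightarrow> nat" where
  "level x = (LEAST i. \<exists>j. N x = N (act i j (base x)))"

definition upward :: "'a \<Rightarrow> bool" where
  "upward x \<longleftrightarrow> (\<exists>j. even j \<and> N x = N (act (level x) j (base x)))"

section \<open>Arithmetic of the action\<close>

lemma r_0: "r 0 = 0"
  using r_add[of 0 0] by simp

lemma r_minus: "r (- x) = - r x"
  using r_add[of x "- x"] by (intro minus_unique[symmetric]) (simp add: r_0)

lemma r_diff: "r (x - y) = r x - r y"
  using r_add[of x "- y"] by (simp add: r_minus)

lemmas r_simps = r_0 r_minus r_diff r_add r_r

lemma r_cube: "(r ^^ 3) x = - x"
  by (simp add: eval_nat_numeral r_simps)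

lemma N_diff: "N x = N x' \<Longrightarrow> N y = N y' \<Longrightarrow> N (x - y) = N (x' - y')"
  using N_add[OF _ N_minus, of x x' y y'] by simp

lemma N_eq_iff: "N x = N y \<longleftrightarrow> N (x - y) = N 0"
  using N_diff[of x y y y] N_add[of "x - y" 0 y y] by auto

lemma r_funpow_6: "(r ^^ (6 * k)) x = x"
proof (induction k)
  case (Suc k)
  have "(r ^^ 6) y = y" for y
    using funpow_add[of 3 3 r] by (simp add: r_cube)
  with Suc show ?case by (simp add: funpow_add)
qed simp

lemma r_funpow_add_3: "(r ^^ (j + 3)) x = - (r ^^ j) x"
  by (subst add.commute) (simp only: funpow_add o_apply r_cube)

lemma act_0_0: "act 0 0 x = x"
  by (simp add: act_def)

lemma act_0: "act i j 0 = 0"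
proof -
  have "(r ^^ j) 0 = 0" by (induction j) (simp_all add: r_0)
  moreover have "(double ^^ i) 0 = 0" by (induction i) simp_all
  ultimately show ?thesis by (simp add: act_def)
qed

lemma act_0_odd:
  assumes "odd d"
  shows "act 0 (d + d + d) x = - x"
proof -
  obtain m where "d = 2 * m + 1" using assms by (rule oddE)
  then have "d + d + d = 6 * m + 3" by simp
  then have "act 0 (d + d + d) x = (r ^^ (6 * m + 3)) x" by (simp only: act_def funpow_0)
  then show ?thesis by (simp only: r_funpow_add_3 r_funpow_6)
qed

lemma act_act: "act i j (act k l x) = act (i + k) (j + l) x"
proof -
  have "r ((double ^^ k) y) = (double ^^ k) (r y)" for y
    by (induction k) (simp_all add: r_simps)
  then have "(r ^^ j) ((double ^^ k) y) = (double ^^ k) ((r ^^ j) y)" for y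
    by (induction j) simp_all
  then show ?thesis by (simp add: act_def funpow_add)
qed

lemma r_act: "r (act i j x) = act i (Suc j) x"
  using act_act[of 0 1 i j x] by (simp add: act_def)

lemma double_act: "act i j x + act i j x = act (Suc i) j x"
  by (simp add: act_def)

lemma N_act: "N x = N y \<Longrightarrow> N (act i j x) = N (act i j y)"
proof -
  assume "N x = N y"
  then have "N ((r ^^ j) x) = N ((r ^^ j) y)" by (induction j) (auto intro: N_r)
  then show ?thesis unfolding act_def by (induction i) (auto intro: N_add)
qed

lemma N_act_period: "N (act (e * i) (6 * j) x) = N x"
proof -
  have "N ((double ^^ (e * i)) y) = N y" for y
    by (induction i) (simp_all only: mult_0_right mult_Suc_right funpow_add o_apply N_double_e funpow_0)
  then show ?thesis by (simp add: act_def r_funpow_6)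
qed

text \<open>The exponents \<open>e * i - i\<close> and \<open>6 * j - j\<close> complete
  \<open>i\<close> and \<open>j\<close> to multiples of the periods and so undo the action.\<close>

lemma N_act_cancel:
  assumes "N (act i j x) = N (act i j y)"
  shows "N x = N y"
proof -
  have "N (act (e * i) (6 * j) x) = N (act (e * i) (6 * j) y)"
    using N_act[OF assms, of "e * i - i" "6 * j - j"] e_pos by (simp add: act_act)
  then show ?thesis by (simp only: N_act_period)
qed

lemma N_r_iff: "N (r x) = N (r y) \<longleftrightarrow> N x = N y"
  using N_act_cancel[of 0 1 x y] N_r[of x y] by (auto simp: act_def)

lemma N_double_iff: "N (x + x) = N (y + y) \<longleftrightarrow> N x = N y"
  using N_act_cancel[of 1 0 x y] N_add[of x y x y] by (auto simp: act_def)

lemma N_r_ne_0: "N x \<noteq> N 0 \<Longrightarrow> N (r x) \<noteq> N 0"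
  using N_r_iff[of x 0] by (simp add: r_0)

lemma N_double_ne_0: "N x \<noteq> N 0 \<Longrightarrow> N (x + x) \<noteq> N 0"
  using N_double_iff[of x 0] by simp

lemma N_minus_ne_0: "N x \<noteq> N 0 \<Longrightarrow> N (- x) \<noteq> N 0"
  using N_minus[of "- x" 0] by auto

lemma N_half: "\<exists>h. N x = N (h + h)"
proof
  show "N x = N (act (e - 1) 0 x + act (e - 1) 0 x)"
    using N_double_e[of x] e_pos by (simp add: double_act) (simp add: act_def)
qed

section \<open>Orbits, levels and signs\<close>

lemma orbit_refl: "x \<in> orbit x"
  unfolding orbit_def by (metis (mono_tags, lifting) act_0_0 mem_Collect_eq)

lemma orbit_eq:
  assumes "y \<in> orbit x"
  shows "orbit y = orbit x"
proof -
  obtain i j where y: "N y = N (act i j x)" using assms by (auto simp: orbit_def)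
  have "N x = N (act (e * i - i) (6 * j - j) y)"
    using N_act[OF y, of "e * i - i" "6 * j - j"] e_pos by (simp add: act_act N_act_period)
  moreover have "orbit u \<subseteq> orbit v" if "N u = N (act i j v)" for u v i j
    unfolding orbit_def using N_act[OF that] by (auto simp: act_act)
  ultimately show ?thesis using y by blast
qed

lemma orbit_act: "orbit (act i j x) = orbit x"
  by (rule orbit_eq) (auto simp: orbit_def)

lemma orbit_cong: "N x = N y \<Longrightarrow> orbit x = orbit y"
  by (rule orbit_eq) (metis (mono_tags, lifting) act_0_0 mem_Collect_eq orbit_def)

lemma base_cong: "orbit x = orbit y \<Longrightarrow> base x = base y"
  by (simp add: base_def)

lemma level: "\<exists>j. N x = N (act (level x) j (base x))"
proof -
  have "base x \<in> orbit x" unfolding base_def using orbit_refl by (rule someI)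
  then have "x \<in> orbit (base x)" using orbit_eq orbit_refl by blast
  then have "\<exists>i j. N x = N (act i j (base x))" by (simp add: orbit_def)
  then show ?thesis unfolding level_def by (rule LeastI_ex)
qed

lemma level_le: "N x = N (act i j (base x)) \<Longrightarrow> level x \<le> i"
  unfolding level_def by (rule Least_le) blast

lemma base_nonzero:
  assumes "N x \<noteq> N 0"
  shows "N (base x) \<noteq> N 0"
proof
  assume "N (base x) = N 0"
  then have "N (act i j (base x)) = N 0" for i j
    using N_act[of "base x" 0 i j] by (simp add: act_0)
  with level assms show False by metis
qed

text \<open>If an even and an odd power of \<open>r\<close> agree at \<open>x\<close>, then an odd
  power fixes \<open>x\<close>. Its cube is negation, so \<open>2 x\<close> and hence
  \<open>x\<close> vanish modulo the kernel.\<close>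

lemma parity_unique:
  assumes "N x \<noteq> N 0" "N (act i j x) = N (act i k x)"
  shows "even j \<longleftrightarrow> even k"
proof -
  have False if "N (act i j x) = N (act i k x)" "even j" "odd k" for j k
  proof -
    have jk: "N (act 0 j x) = N (act 0 k x)"
      using that(1) N_act_cancel[of i 0 "act 0 j x" "act 0 k x"] by (simp add: act_act)
    \<comment> \<open>\<open>5 * j\<close> completes \<open>j\<close> to \<open>6 * j\<close>, a
      multiple of the period of \<open>r\<close>, so \<open>d\<close> stands for
      \<open>k - j\<close> without negative exponents.\<close>
    define d where "d = 5 * j + k"
    have "act 0 (5 * j) (act 0 j x) = act (e * 0) (6 * j) x" by (simp add: act_act)
    then have d: "N x = N (act 0 d x)"
      using N_act[OF jk, of 0 "5 * j"] N_act_period[of 0 j x] by (simp only: act_act d_def add_0)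
    have "odd d" using that by (simp add: d_def)
    have "N (act 0 (d + d + d) x) = N (act 0 (d + d) (act 0 d x))" by (simp add: act_act)
    also have "\<dots> = N (act 0 d (act 0 d x))"
      using N_act[OF d, of 0 "d + d"] by (simp add: act_act)
    also have "\<dots> = N x" using N_act[OF d, of 0 d] d by simp
    finally have "N (- x) = N x" by (simp only: act_0_odd[OF \<open>odd d\<close>])
    then have "N (x + x) = N 0" using N_eq_iff[of x "- x"] by simp
    then show False using N_double_iff[of x 0] assms(1) by simp
  qed
  from this[of j k] this[of k j] assms(2) show ?thesis by argo
qed

lemma upward_iff:
  assumes "N x \<noteq> N 0" "N x = N (act (level x) j (base x))"
  shows "upward x \<longleftrightarrow> even j"
  unfolding upward_def using assms parity_unique[OF base_nonzero] by metis

lemma upward_cong: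
  assumes "N x = N y"
  shows "upward x = upward y"
proof -
  have "base x = base y" using assms orbit_cong base_cong by blast
  then show ?thesis using assms by (simp add: upward_def level_def)
qed

text \<open>Multiplication by \<open>r\<close> keeps the level and shifts the exponent of
  \<open>r\<close> by one.\<close>

lemma upward_r:
  assumes "N x \<noteq> N 0"
  shows "upward (r x) \<longleftrightarrow> \<not> upward x"
proof -
  have base: "base (r x) = base x"
    using orbit_act[of 0 1 x] by (intro base_cong) (simp add: act_def)
  have *: "N (r x) = N (act i (Suc j) (base x)) \<longleftrightarrow> N x = N (act i j (base x))" for i j
    by (simp only: r_act[symmetric] N_r_iff)
  obtain j where j: "N x = N (act (level x) j (base x))" using level by blast
  obtain k where k: "N (r x) = N (act (level (r x)) k (base x))" using level base by metis
  \<comment> \<open>Adding the period 6 makes the exponent a successor even for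
    \<open>k = 0\<close>, so that one \<open>r\<close> can be cancelled.\<close>
  have "act (level (r x)) (Suc (k + 5)) (base x) = act (level (r x)) k (base x)"
    using r_funpow_6[of 1] by (simp add: act_def funpow_add flip: add_Suc_right)
  then have "N (r x) = N (act (level (r x)) (Suc (k + 5)) (base x))"
    using k by (simp only:)
  then have "N x = N (act (level (r x)) (k + 5) (base x))" by (simp only: *)
  then have "level x \<le> level (r x)" by (rule level_le)
  moreover have "level (r x) \<le> level x"
    using j * base by (intro level_le[of _ _ "Suc j"]) simp
  ultimately have "level (r x) = level x" by simp
  then have "upward (r x) \<longleftrightarrow> even (Suc j)"
    using j * base assms N_r_iff[of x 0] by (intro upward_iff) (simp_all add: r_0)
  moreover have "upward x \<longleftrightarrow> even j" using assms j by (rule upward_iff)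
  ultimately show ?thesis by simp
qed

lemma upward_minus:
  assumes "N x \<noteq> N 0"
  shows "upward (- x) \<longleftrightarrow> \<not> upward x"
proof -
  have "- x = r (r (r x))" by (simp add: r_simps)
  moreover have "N (r x) \<noteq> N 0" "N (r (r x)) \<noteq> N 0"
    using assms N_r_ne_0 by blast+
  ultimately show ?thesis using assms upward_r by metis
qed

text \<open>The level of \<open>2 x\<close> exceeds that of \<open>x\<close> by one, unless the cycle of doublings closes up there.\<close>

lemma upward_double:
  assumes "N x \<noteq> N 0" "level (x + x) \<noteq> 0"
  shows "upward (x + x) = upward x"
proof -
  have base: "base (x + x) = base x"
    using orbit_act[of 1 0 x] by (intro base_cong) (simp add: act_def)
  have *: "N (x + x) = N (act (Suc i) j (base x)) \<longleftrightarrow> N x = N (act i j (base x))" for i j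
    by (simp only: double_act[symmetric] N_double_iff)
  obtain j where j: "N x = N (act (level x) j (base x))" using level by blast
  obtain l where l: "level (x + x) = Suc l" using assms(2) not0_implies_Suc by blast
  obtain k where k: "N (x + x) = N (act (Suc l) k (base x))" using level base l by metis
  have "level (x + x) \<le> Suc (level x)"
    using j * base by (intro level_le[of _ _ j]) simp
  moreover have "level x \<le> l" using k * by (intro level_le) simp
  ultimately have "level (x + x) = Suc (level x)" using l by simp
  then have "upward (x + x) \<longleftrightarrow> even j"
    using j * base assms N_double_iff[of x 0] by (intro upward_iff) simp_all
  then show ?thesis using upward_iff[OF assms(1) j] by simp
qed

text \<open>\<open>2 x\<close> has the sign of \<open>x\<close> unless its level is 0. If then
  \<open>x\<close> has positive level, its half has the sign of \<open>x\<close>. If both levels are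
  0, \<open>x\<close> and \<open>2 x\<close> differ by a power of \<open>r\<close>, which must be
  even.\<close>

lemma upward_double_or_half:
  assumes "N x \<noteq> N 0"
  shows "upward (x + x) = upward x \<or> (\<exists>h. N x = N (h + h) \<and> upward h = upward x)"
proof (cases "level (x + x) = 0 \<and> level x = 0")
  case False
  show ?thesis
  proof (cases "level (x + x) = 0")
    case True
    obtain h where h: "N x = N (h + h)" using N_half by blast
    have "base x = base (h + h)" using h orbit_cong base_cong by blast
    then have "level x = level (h + h)" using h by (simp add: level_def)
    then have "upward (h + h) = upward h"
      using False True h assms N_double_iff[of h 0] by (intro upward_double) auto
    then show ?thesis using h upward_cong by blast
  next
    case False
    then show ?thesis using upward_double assms by blast
  qed
next
  case True
  have base: "base (x + x) = base x"
    using orbit_act[of 1 0 x] by (intro base_cong) (simp add: act_def)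
  obtain j where j: "N x = N (act 0 j (base x))" using level True by metis
  obtain k where k: "N (x + x) = N (act 0 k (base x))" using level True base by metis
  have "even j = even k"
  proof (rule ccontr)
    txt \<open>Otherwise \<open>2 x\<close> is an odd power of \<open>r\<close> applied to \<open>x\<close>; cubing gives \<open>8 x = - x\<close>.\<close>
    assume neq: "even j \<noteq> even k"
    define d where "d = 5 * j + k"
    have d: "N (act 0 d x) = N (act 1 0 x)"
    proof -
      have "N (act 0 d x) = N (act 0 d (act 0 j (base x)))" by (rule N_act[OF j])
      also have "\<dots> = N (act (e * 0) (6 * j) (act 0 k (base x)))"
        by (simp add: act_act d_def ac_simps)
      also have "\<dots> = N (act 1 0 x)"
        using k by (simp only: N_act_period) (simp add: act_def)
      finally show ?thesis .
    qed
    have "odd d" using neq by (auto simp: d_def)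
    have "N (- x) = N (act 0 (d + d) (act 0 d x))"
      using act_0_odd[OF \<open>odd d\<close>, of x] by (simp add: act_act)
    also have "\<dots> = N (act 1 d (act 0 d x))"
      using N_act[OF d, of 0 "d + d"] by (simp add: act_act)
    also have "\<dots> = N (act 2 0 (act 0 d x))"
      using N_act[OF d, of 1 d] by (simp add: act_act eval_nat_numeral)
    also have "\<dots> = N (act 3 0 x)"
      using N_act[OF d, of 2 0] by (simp add: act_act)
    finally have "N (act 3 0 x) = N (- x)" by simp
    then have "N (act 3 0 x - - x) = N 0" using N_eq_iff by blast
    \<comment> \<open>\<open>9 x\<close> is written as three times \<open>3 x\<close>, so that
      \<open>N_triple\<close> applies twice.\<close>
    moreover have "act 3 0 x - - x = (x + x + x) + (x + x + x) + (x + x + x)"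
      by (simp add: act_def eval_nat_numeral algebra_simps)
    ultimately show False using N_triple assms by metis
  qed
  moreover have "upward (x + x) \<longleftrightarrow> even k"
    using k True base assms N_double_iff[of x 0] by (intro upward_iff) simp_all
  moreover have "upward x \<longleftrightarrow> even j"
    using j True assms by (intro upward_iff) simp_all
  ultimately show ?thesis by simp
qed

section \<open>Equilateral triangles\<close>

text \<open>\<open>r\<close> turns by 60 degrees, so the two formulas give the apexes on either side
  of the segment; the value at congruent points makes the operation idempotent.\<close>

definition third :: "'a \<Rightarrow> 'a \<Rightarrow> 'a" where
  "third x y = (if N x = N y then x else if upward (y - x) then x + r (y - x) else y - r (y - x))"

lemma third_cong:
  assumes "N x = N x'" "N y = N y'"
  shows "N (third x y) = N (third x' y')"
proof -
  have "upward (y - x) = upward (y' - x')" using assms by (intro upward_cong N_diff)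
  then show ?thesis using assms by (auto simp: third_def intro!: N_add N_diff N_r)
qed

lemma third_pos: "N d \<noteq> N 0 \<Longrightarrow> upward d \<Longrightarrow> third x (x + d) = x + r d"
  using N_eq_iff[of "x + d" x] by (auto simp: third_def)

lemma third_neg: "N d \<noteq> N 0 \<Longrightarrow> \<not> upward d \<Longrightarrow> third x (x + d) = x + d - r d"
  using N_eq_iff[of "x + d" x] by (auto simp: third_def)

text \<open>Swapping the points negates their difference. This flips the sign and also exchanges the
  two formulas, so the apex stays.\<close>

lemma third_comm: "N (third x y) = N (third y x)"
proof (cases "N x = N y")
  case False
  then have "N (y - x) \<noteq> N 0" using N_eq_iff by metis
  then have "upward (x - y) \<longleftrightarrow> \<not> upward (y - x)" using upward_minus[of "y - x"] by simp
  moreover have "r (x - y) = - r (y - x)" by (simp add: r_simps)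
  ultimately show ?thesis using False by (auto simp: third_def)
qed (simp add: third_def)

text \<open>Seen from \<open>x\<close>, the apex lies in direction \<open>r d\<close> or
  \<open>- r (r d)\<close>. Both are odd powers of \<open>r\<close> applied to \<open>d\<close>, so
  the sign is opposite and the second step turns back to \<open>d\<close>.\<close>

lemma third_third: "N (third x (third x y)) = N y"
proof (cases "N x = N y")
  case True
  then have "third x y = x" by (simp add: third_def)
  with True show ?thesis by (simp add: third_def)
next
  case False
  define d where "d = y - x"
  have y: "y = x + d" by (simp add: d_def)
  have d: "N d \<noteq> N 0" using False N_eq_iff unfolding d_def by metis
  then have rd: "N (r d) \<noteq> N 0" "N (r (r d)) \<noteq> N 0"
    using N_r_ne_0 by blast+
  have "N (- r (r d)) \<noteq> N 0" using rd(2) by (rule N_minus_ne_0)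
  moreover have "upward (r d) \<longleftrightarrow> \<not> upward d" "upward (- r (r d)) \<longleftrightarrow> \<not> upward d"
    using upward_r[OF d] upward_r[OF rd(1)] upward_minus[OF rd(2)] by auto
  moreover have "third x y = x + (if upward d then r d else - r (r d))"
    using third_pos[OF d] third_neg[OF d] by (simp add: y r_r)
  ultimately have "third x (third x y) = y"
    using third_pos[of "- r (r d)" x] third_neg[of "r d" x] rd
    by (auto simp: y r_simps split: if_splits)
  then show ?thesis by simp
qed

text \<open>The configuration is the triangle of side \<open>2 h\<close> at \<open>a\<close> with
  its three corner triangles. In \<open>?double\<close> the given block is the corner triangle at
  \<open>a\<close>, in \<open>?half\<close> the large one.\<close>

lemma pasch_double:
  assumes h: "N h \<noteq> N 0" "upward (h + h) = upward h"
  shows "third (third (a + h) (a + (h + h))) (third a (a + h)) = third a (a + (h + h))" (is ?double)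
    and "third (third (a + (h + h)) (a + h)) (third a (a + (h + h))) = third a (a + h)" (is ?half)
proof -
  note hh = N_double_ne_0[OF h(1)]
  have rh: "N (r h) \<noteq> N 0" "N (r (r h)) \<noteq> N 0"
    using h(1) N_r_ne_0 by blast+
  have minus: "N (- h) \<noteq> N 0" "N (- r h) \<noteq> N 0"
    using h(1) rh(1) N_minus_ne_0 by blast+
  have upwards: "upward (- h) \<longleftrightarrow> \<not> upward h" "upward (- r h) \<longleftrightarrow> upward h" "upward (r (r h)) \<longleftrightarrow> upward h"
    using upward_minus[OF h(1)] upward_minus[OF rh(1)] upward_r[OF h(1)] upward_r[OF rh(1)] by auto
  have "?double \<and> ?half"
  proof (cases "upward h")
    case True
    have 1: "third a (a + h) = a + r h" "third a (a + (h + h)) = a + r (h + h)"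
      using third_pos h hh True by auto
    have 2: "third (a + h) (a + (h + h)) = a + h + r h"
      using third_pos[of h "a + h"] h True by (simp add: add.assoc)
    have 3: "third (a + (h + h)) (a + h) = a + h + r h"
      using third_neg[of "- h" "a + (h + h)"] minus upwards True by (simp add: r_simps algebra_simps)
    have 4: "third (a + h + r h) (a + r h) = a + r (h + h)"
      using third_neg[of "- h" "a + h + r h"] minus upwards True by (simp add: r_simps algebra_simps)
    have 5: "third (a + h + r h) (a + r (h + h)) = a + r h"
      using third_pos[of "r (r h)" "a + h + r h"] rh upwards True by (simp add: r_simps algebra_simps)
    show ?thesis unfolding 1 2 3 4 5 by simp
  next
    case False
    have 1: "third a (a + h) = a + h - r h" "third a (a + (h + h)) = a + (h + h) - r (h + h)"
      using third_neg h hh False by auto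
    have 2: "third (a + h) (a + (h + h)) = a + (h + h) - r h"
      using third_neg[of h "a + h"] h False by (simp add: add.assoc)
    have 3: "third (a + (h + h)) (a + h) = a + (h + h) - r h"
      using third_pos[of "- h" "a + (h + h)"] minus upwards False by (simp add: r_simps algebra_simps)
    have 4: "third (a + (h + h) - r h) (a + h - r h) = a + (h + h) - r (h + h)"
      using third_pos[of "- h" "a + (h + h) - r h"] minus upwards False
      by (simp add: r_simps algebra_simps)
    have 5: "third (a + (h + h) - r h) (a + (h + h) - r (h + h)) = a + h - r h"
      using third_neg[of "- r h" "a + (h + h) - r h"] minus upwards False
      by (simp add: r_simps algebra_simps)
    show ?thesis unfolding 1 2 3 4 5 by simp
  qed
  then show ?double ?half by blast+
qed

section \<open>The fourth point avoids the block\<close>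

text \<open>\<open>(r - 2) (r + 1) = -3\<close>, and tripling is injective modulo the
  kernel.\<close>

lemma N_r_ne_double:
  assumes "N h \<noteq> N 0"
  shows "N (r h) \<noteq> N (h + h)"
proof
  assume *: "N (r h) = N (h + h)"
  have "N (r h - h) = N (r h + r h)" using N_r[OF *] by (simp add: r_simps)
  then have "N (r h - h - r h) = N (r h + r h - r h)" by (rule N_diff) simp
  then have "N (- h) = N (r h)" by simp
  with * have "N (- h) = N (h + h)" by simp
  then have "N (- h + h) = N (h + h + h)" by (rule N_add) simp
  then show False using N_triple[of h] assms by simp
qed

text \<open>Multiplying \<open>2 r - 1\<close> by \<open>r\<close> gives \<open>r - 2\<close>, the
  previous case.\<close>

lemma N_double_r_ne:
  assumes "N h \<noteq> N 0"
  shows "N (r h + r h) \<noteq> N h"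
proof
  assume "N (r h + r h) = N h"
  then have "N (r (r h + r h)) = N (r h)" by (rule N_r)
  then have "N (r (r h + r h) - r h) = N (r h - r h)" by (rule N_diff) simp
  then have "N (r h - (h + h)) = N 0" by (simp add: r_simps algebra_simps)
  then show False using N_eq_iff[of "r h" "h + h"] N_r_ne_double[OF assms] by blast
qed

lemma N_diff_r_ne_double:
  assumes "N h \<noteq> N 0"
  shows "N (h - r h) \<noteq> N (h + h)"
proof
  assume "N (h - r h) = N (h + h)"
  then have "N (r (h - r h)) = N (r (h + h))" by (rule N_r)
  then have "N (r (h - r h) - r (h + h)) = N (r (h + h) - r (h + h))" by (rule N_diff) simp
  then have "N (h - (r h + r h)) = N 0" by (simp add: r_simps algebra_simps)
  then show False using N_eq_iff[of h "r h + r h"] N_double_r_ne[OF assms] by force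
qed

lemma third_ne_double:
  assumes "N h \<noteq> N 0"
  shows "N (third a (a + h)) \<noteq> N (a + (h + h))"
proof
  assume "N (third a (a + h)) = N (a + (h + h))"
  then have "N (third a (a + h) - a) = N (a + (h + h) - a)" by (rule N_diff) simp
  then show False
    using N_r_ne_double[OF assms] N_diff_r_ne_double[OF assms]
      third_pos[OF assms, of a] third_neg[OF assms, of a] by (cases "upward h") auto
qed

lemma third_double_ne:
  assumes "N h \<noteq> N 0"
  shows "N (third a (a + (h + h))) \<noteq> N (a + h)"
proof
  assume "N (third a (a + (h + h))) = N (a + h)"
  then have *: "N (third a (a + (h + h)) - (a + h)) = N 0"
    using N_eq_iff[of "third a (a + (h + h))"] by blast
  show False
  proof (cases "upward (h + h)")
    case True
    then have "N (r h + r h - h) = N 0"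
      using * third_pos[OF N_double_ne_0[OF assms], of a] by (simp add: r_simps algebra_simps)
    then show False using N_eq_iff[of "r h + r h" h] N_double_r_ne[OF assms] by blast
  next
    case False
    then have "N (h - (r h + r h)) = N 0"
      using * third_neg[OF N_double_ne_0[OF assms], of a] by (simp add: r_simps algebra_simps)
    then show False using N_eq_iff[of h "r h + r h"] N_double_r_ne[OF assms] by force
  qed
qed

lemma N_add_left_iff: "N (a + x) = N (a + y) \<longleftrightarrow> N x = N y"
  using N_eq_iff[of "a + x" "a + y"] N_eq_iff[of x y] by simp

lemma pasch_point:
  assumes "N a \<noteq> N b"
  shows "\<exists>d. N d \<noteq> N a \<and> N d \<noteq> N b \<and> N d \<noteq> N (third a b) \<and>
    N (third (third b d) (third a b)) = N (third a d)"
proof -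
  define \<delta> where "\<delta> = b - a"
  have b: "b = a + \<delta>" by (simp add: \<delta>_def)
  have \<delta>: "N \<delta> \<noteq> N 0" using assms N_eq_iff[of b a] by (auto simp: \<delta>_def)
  show ?thesis
  proof (cases "upward (\<delta> + \<delta>) = upward \<delta>")
    case True
    \<comment> \<open>The block is a corner triangle, and \<open>d\<close> is the far end of the
      doubled side.\<close>
    show ?thesis
      using pasch_double(1)[OF \<delta> True, of a] third_ne_double[OF \<delta>, of a] N_double_ne_0[OF \<delta>]
        N_add_left_iff[of a "\<delta> + \<delta>" 0] N_add_left_iff[of "a + \<delta>" \<delta> 0] \<delta>
      by (intro exI[of _ "a + (\<delta> + \<delta>)"]) (auto simp: b add.assoc)
  next
    case False
    then obtain h where h: "N \<delta> = N (h + h)" "upward h = upward \<delta>"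
      using upward_double_or_half[OF \<delta>] by blast
    have h0: "N h \<noteq> N 0" using \<delta> h(1) N_double_iff[of h 0] by auto
    have upward: "upward (h + h) = upward h" using h upward_cong by metis
    \<comment> \<open>The block is now the large triangle and \<open>d\<close> the midpoint
      \<open>a + h\<close>. As \<open>b\<close> is only congruent to \<open>a + (h + h)\<close>,
      that point replaces it.\<close>
    define b' where "b' = a + (h + h)"
    have b': "N b = N b'" unfolding b b'_def using h(1) by (intro N_add) auto
    have tab: "N (third a b) = N (third a b')" by (intro third_cong refl b')
    have "N (third (third b (a + h)) (third a b)) = N (third (third b' (a + h)) (third a b'))"
      by (intro third_cong refl b')
    moreover have "N (a + h) \<noteq> N b'"
      using N_add_left_iff[of "a + h" 0 h] h0 by (simp add: b'_def add.assoc)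
    moreover have "N (a + h) \<noteq> N a" using N_add_left_iff[of a h 0] h0 by simp
    ultimately show ?thesis
      using pasch_double(2)[OF h0 upward, of a] third_double_ne[OF h0, of a] b' tab
      by (intro exI[of _ "a + h"]) (auto simp: b'_def)
  qed
qed

lemma pasch_order_quotient: "pasch_order (card (range N))"
proof (rule pasch_orderI)
  define f where "f u v = N (third (inv_into UNIV N u) (inv_into UNIV N v))" for u v
  have f: "f (N x) (N y) = N (third x y)" for x y
    unfolding f_def by (intro third_cong f_inv_into_f) auto
  have "third x x = x" for x by (simp add: third_def)
  then show "pasch_quasigroup (range N) f"
    unfolding pasch_quasigroup_def using finite_N pasch_point
    by (auto simp: f third_third intro: third_comm)
qed

end

section \<open>Primes and squares of primes\<close>

lemma sixth_root_mod_prime: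
  fixes p :: nat
  assumes "prime p" "p = 6 * t + 1"
  shows "\<exists>g::int. int p dvd g * g - g + 1"
proof -
  have p1: "p > 1" using assms(1) by (rule prime_gt_1_nat)
  then have t: "t > 0" using assms(2) by (cases t) auto
  obtain a where a: "residue_primroot p a"
    using prime_primitive_root_exists[OF p1 assms(1)] by blast
  then have ord: "ord p a = 6 * t"
    using assms totient_prime[OF assms(1)] by (simp add: residue_primroot_def)
  have not1: "\<not> [a ^ m = 1] (mod p)" if "0 < m" "m < 6 * t" for m
    using that ord ord_divides[of a m p] by (auto dest: dvd_imp_le)
  \<comment> \<open>A primitive root to the power \<open>t\<close> has order 6. In
    \<open>w^6 - 1 = (w^3 - 1) (w + 1) (w^2 - w + 1)\<close> only the last factor can then vanish
    modulo \<open>p\<close>.\<close>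
  define w where "w = int a ^ t"
  have w: "int p dvd w ^ m - 1 \<longleftrightarrow> [a ^ (t * m) = 1] (mod p)" for m
    by (simp add: w_def power_mult cong_iff_dvd_diff flip: cong_int_iff)
  have "[a ^ (6 * t) = 1] (mod p)" using ord ord_works[of a p] by simp
  then have "int p dvd w ^ 6 - 1" using w[of 6] by (simp add: mult.commute)
  also have "w ^ 6 - 1 = (w ^ 3 - 1) * ((w + 1) * (w * w - w + 1))"
    by (simp add: eval_nat_numeral algebra_simps)
  finally have "int p dvd w ^ 3 - 1 \<or> int p dvd w + 1 \<or> int p dvd w * w - w + 1"
    using assms(1) by (simp add: prime_dvd_mult_iff)
  moreover have "\<not> int p dvd w ^ 3 - 1" "\<not> int p dvd w ^ 2 - 1"
    unfolding w using not1 t by simp_all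
  moreover have "w ^ 2 - 1 = (w + 1) * (w - 1)" by (simp add: power2_eq_square algebra_simps)
  ultimately show ?thesis by (metis dvd_mult2)
qed

lemma funpow_double_pair: "((\<lambda>x. x + x) ^^ n) (a :: int, b :: int) = (2 ^ n * a, 2 ^ n * b)"
  by (induction n) (simp_all add: algebra_simps)

lemma two_power_mod_prime:
  fixes p :: nat
  assumes "prime p" "p > 3"
  shows "[2 ^ (p - 1) = 1] (mod int p)"
proof -
  have "\<not> p dvd 2" using assms(2) by (auto dest: dvd_imp_le)
  then have "[2 ^ (p - 1) = 1] (mod p)" by (rule fermat_theorem[OF assms(1)])
  then show ?thesis by (simp flip: cong_int_iff)
qed

lemma triple_mod_prime:
  fixes p :: nat and x :: int
  assumes "prime p" "p > 3" "int p dvd 3 * x"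
  shows "int p dvd x"
proof -
  have "\<not> int p dvd 3" using assms(2) by (auto dest: zdvd_imp_le)
  then show ?thesis using assms by (simp add: prime_dvd_mult_iff)
qed

text \<open>The quotient by the ideal of \<open>p\<close> and \<open>\<rho> - g\<close> is the field
  with \<open>p\<close> elements. Pairs are kept upstairs because \<open>r_r\<close> must hold
  exactly, while \<open>g * g = g - 1\<close> holds only modulo \<open>p\<close>.\<close>

lemma pasch_order_prime:
  assumes "prime p" "p = 6 * t + 1"
  shows "pasch_order p"
proof -
  have p3: "p > 3" using prime_gt_1_nat[OF assms(1)] assms(2) by (cases t) auto
  obtain g where g: "int p dvd g * g - g + 1" using sixth_root_mod_prime[OF assms] by blast
  txt \<open>The pair \<open>(a, b)\<close> stands for \<open>a + b \<rho>\<close> with \<open>\<rho>\<close> a sixth root of unity, which \<open>l\<close> sends to \<open>g\<close>.\<close>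
  define r :: "int \<times> int \<Rightarrow> int \<times> int" where "r = (\<lambda>(a, b). (- b, a + b))"
  define l :: "int \<times> int \<Rightarrow> int" where "l = (\<lambda>(a, b). a + g * b)"
  define N where "N = (\<lambda>x. l x mod int p)"
  have l: "l (x + y) = l x + l y" "l (- x) = - l x" "l 0 = 0" for x y
    by (auto simp: l_def zero_prod_def algebra_simps split: prod.splits)
  have N: "N x = N y \<longleftrightarrow> [l x = l y] (mod int p)" for x y
    by (simp add: N_def cong_def)
  have lr: "[l (r x) = g * l x] (mod int p)" for x
  proof -
    obtain a b where x: "x = (a, b)" by fastforce
    have "l (r x) - g * l x = - (b * (g * g - g + 1))"
      by (simp add: x l_def r_def algebra_simps)
    then show ?thesis using g by (simp add: cong_iff_dvd_diff)
  qed
  have range: "range N = {0..<int p}"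
  proof
    show "range N \<subseteq> {0..<int p}" using p3 by (auto simp: N_def)
    show "{0..<int p} \<subseteq> range N"
    proof
      fix a assume "a \<in> {0..<int p}"
      then have "a = N (a, 0)" by (simp add: N_def l_def)
      then show "a \<in> range N" by blast
    qed
  qed
  \<comment> \<open>By Fermat's theorem, doubling has period \<open>p - 1\<close> modulo
    \<open>p\<close>.\<close>
  interpret eisenstein_quotient r N "p - 1"
  proof
    fix x y x' y'
    show "r (x + y) = r x + r y" "r (r x) = r x - x"
      by (auto simp: r_def split: prod.splits)
    show "N (x + y) = N (x' + y')" if "N x = N x'" "N y = N y'"
      using that by (simp add: N l cong_add)
    show "N (- x) = N (- y)" if "N x = N y"
      using that by (simp add: N l cong_minus_minus_iff)
    show "N (r x) = N (r y)" if "N x = N y"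
      using that unfolding N by (meson lr cong_scalar_left cong_sym cong_trans)
    show "p - 1 > 0" using p3 by simp
    have "l (((\<lambda>x. x + x) ^^ (p - 1)) x) = 2 ^ (p - 1) * l x"
      by (cases x) (simp add: funpow_double_pair l_def algebra_simps)
    then show "N (((\<lambda>x. x + x) ^^ (p - 1)) x) = N x"
      using cong_scalar_right[OF two_power_mod_prime[OF assms(1) p3], of "l x"] by (simp add: N)
    show "N x = N 0" if "N (x + x + x) = N 0"
      using that triple_mod_prime[OF assms(1) p3, of "l x"] by (simp add: N l cong_0_iff)
    show "finite (range N)" unfolding range by simp
  qed
  show ?thesis using pasch_order_quotient by (simp add: range)
qed

text \<open>Here the ideal is generated by \<open>p\<close> alone, so \<open>N\<close> reduces both
  coordinates; \<open>r\<close> is again multiplication by \<open>\<rho>\<close>.\<close>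

lemma pasch_order_prime_square:
  assumes "prime p" "p + 1 = 6 * t"
  shows "pasch_order (p ^ 2)"
proof -
  have p3: "p > 3" using prime_gt_1_nat[OF assms(1)] assms(2) by (cases t) auto
  define r :: "int \<times> int \<Rightarrow> int \<times> int" where "r = (\<lambda>(a, b). (- b, a + b))"
  define N :: "int \<times> int \<Rightarrow> int \<times> int" where "N = (\<lambda>(a, b). (a mod int p, b mod int p))"
  have N: "N x = N y \<longleftrightarrow> [fst x = fst y] (mod int p) \<and> [snd x = snd y] (mod int p)" for x y
    by (auto simp: N_def cong_def split: prod.splits)
  have range: "range N = {0..<int p} \<times> {0..<int p}"
  proof
    show "range N \<subseteq> {0..<int p} \<times> {0..<int p}" using p3 by (auto simp: N_def)
    show "{0..<int p} \<times> {0..<int p} \<subseteq> range N"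
    proof
      fix a assume "a \<in> {0..<int p} \<times> {0..<int p}"
      then have "a = N a" by (auto simp: N_def)
      then show "a \<in> range N" by blast
    qed
  qed
  interpret eisenstein_quotient r N "p - 1"
  proof
    fix x y x' y'
    show "r (x + y) = r x + r y" "r (r x) = r x - x"
      by (auto simp: r_def split: prod.splits)
    show "N (x + y) = N (x' + y')" if "N x = N x'" "N y = N y'"
      using that by (simp add: N cong_add)
    show "N (- x) = N (- y)" if "N x = N y"
      using that by (simp add: N cong_minus_minus_iff)
    show "N (r x) = N (r y)" if "N x = N y"
      using that by (auto simp: N r_def cong_add cong_minus_minus_iff split: prod.splits)
    show "p - 1 > 0" using p3 by simp
    show "N (((\<lambda>x. x + x) ^^ (p - 1)) x) = N x"
      using cong_scalar_right[OF two_power_mod_prime[OF assms(1) p3], of "fst x"]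
        cong_scalar_right[OF two_power_mod_prime[OF assms(1) p3], of "snd x"]
      by (cases x) (simp add: N funpow_double_pair)
    show "N x = N 0" if "N (x + x + x) = N 0"
      using that triple_mod_prime[OF assms(1) p3, of "fst x"]
        triple_mod_prime[OF assms(1) p3, of "snd x"] by (simp add: N cong_0_iff)
    show "finite (range N)" unfolding range by simp
  qed
  show ?thesis
    using pasch_order_quotient by (simp add: range card_cartesian_product power2_eq_square)
qed

section \<open>Assembling the factors\<close>

lemma pasch_order_admissible_factor: "admissible_factor m \<Longrightarrow> pasch_order m"
  unfolding admissible_factor_def
  using pasch_order_prime pasch_order_prime_square pasch_order_projective_space by blast

theorem theorem3p3:
  fixes n :: nat and ms :: "nat list"
  assumes "ms \<noteq> []"
    and "\<forall>m\<in>set ms. admissible_factor m"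
    and "n = prod_list ms"
  shows "\<exists>(X :: nat set) (S :: nat set set).
           steiner_triple_system X S \<and> card X = n \<and> enough_pasch_configurations S"
proof -
  have "pasch_order (prod_list ms)"
    using assms(2)
    by (induction ms)
      (use pasch_order_1 in \<open>auto intro: pasch_order_mult pasch_order_admissible_factor\<close>)
  then show ?thesis
    unfolding pasch_order_def assms(3) using pasch_quasigroup_steiner by blast
qed

end
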